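(* Let $c>0$ and let $\Sigma\subset\mathbb{L}$ be the holomorphic sphere given by $(\xi,\eta=ci\xi)$, equipped with the metric induced by the neutral Kähler metric $\mathbb{G}$. The geodesic flow on $\Sigma$ is completely integrable with first integrals $$\mathrm{I}_1=\frac{1-\xi\bar\xi}{(1+\xi\bar\xi)^3}\,\dot\xi\dot{\bar\xi},\qquad \mathrm{I}_2=\frac{1-\xi\bar\xi}{2i(1+\xi\bar\xi)^3}\big(\bar\xi\dot\xi-\xi\dot{\bar\xi}\big).$$
   Context: The space $\mathbb{L}$ of oriented affine lines in $\mathbb{R}^3$ is identified with $\mathrm{T}S^2$. Let $\xi$ be the complex coordinate on $S^2\setminus\{\text{south pole}\}$ given by stereographic projection from the south pole; local complex coordinates $(\xi,\eta)$ on $\mathbb{L}$ are defined by $(\xi,\eta)\leftrightarrow \eta\frac{\partial}{\partial\xi}+\bar\eta\frac{\partial}{\partial\bar\xi}\in \mathrm{T}_\xi S^2$. The sphere $(\xi,\eta=ci\xi)$ is the image of the global holomorphic section $\xi\mapsto(\xi,ci\xi)$ of $\mathrm{T}S^2\to S^2$ (extended over the south pole). The neutral Kähler metric on $\mathbb{L}$ is $$\mathbb{G}=\frac{2i}{(1+\xi\bar\xi)^2}\Big(d\eta\otimes d\bar\xi-d\bar\eta\otimes d\xi+\frac{2(\xi\bar\eta-\bar\xi\eta)}{1+\xi\bar\xi}d\xi\otimes d\bar\xi\Big)$$ (products symmetrised). It induces on $\Sigma$ the metric $ds^2=-\frac{4c(1-\xi\bar\xi)}{(1+\xi\bar\xi)^3}d\xi\otimes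 d\bar\xi$, which is degenerate exactly on the equator $|\xi|=1$ and definite on each of the two complementary open discs; the geodesic flow is that of $ds^2$ on these discs. Here $t\mapsto(\xi(t),ci\xi(t))$ is an affinely parameterised geodesic and the dot denotes $d/dt$; a first integral is a function on the tangent bundle constant along all such geodesics. Complete integrability means that there are two Poisson-commuting first integrals which are functionally independent on an open dense set. *)

theory Defs
  imports "HOL-Analysis.Analysis"
begin

section \<open>Parametrised pseudo-Riemannian surfaces and their geodesics\<close>

primrec Ck_on :: "nat \<Rightarrow> 'a::real_normed_vector set \<Rightarrow> ('a \<Rightarrow> 'b::real_normed_vector) \<Rightarrow> bool" where
  "Ck_on 0 S f \<longleftrightarrow> continuous_on S f"
| "Ck_on (Suc k) S f \<longleftrightarrow> (\<forall>x\<in>S. f differentiable at x) \<and>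
     (\<forall>v. Ck_on k S (\<lambda>x. frechet_derivative f (at x) v))"

definition smooth_on :: "'a::real_normed_vector set \<Rightarrow> ('a \<Rightarrow> 'b::real_normed_vector) \<Rightarrow> bool" where
  "smooth_on S f \<longleftrightarrow> (\<forall>k. Ck_on k S f)"

definition tangent_map ::
  "('a::real_normed_vector \<Rightarrow> 'b::real_normed_vector) \<Rightarrow> 'a \<times> 'a \<Rightarrow> 'b \<times> 'b" where
  "tangent_map f = (\<lambda>(x, u). (f x, frechet_derivative f (at x) u))"

text \<open>A field of bilinear forms: base point, then two tangent vectors.\<close>
type_synonym 'a metric = "'a \<Rightarrow> 'a \<Rightarrow> 'a \<Rightarrow> real"

definition pullback ::
  "('a::real_normed_vector \<Rightarrow> 'b::real_normed_vector) \<Rightarrow> 'b metric \<Rightarrow> 'a metric" where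
  "pullback f g = (\<lambda>x u v. g (f x) (frechet_derivative f (at x) u) (frechet_derivative f (at x) v))"

text \<open>The Christoffel symbols of the second kind as a vector-valued bilinear form,
  \<open>christoffel g x u v\<close> having the components $\Gamma^k_{ij}u^iv^j$. It is characterised by
  lowering its index; the vector is unique where \<open>g\<close> is nondegenerate.\<close>
definition christoffel :: "'a::real_normed_vector metric \<Rightarrow> 'a \<Rightarrow> 'a \<Rightarrow> 'a \<Rightarrow> 'a" where
  "christoffel g x u v = (THE z. \<forall>w. g x z w =
     (frechet_derivative (\<lambda>y. g y v w) (at x) u
      + frechet_derivative (\<lambda>y. g y u w) (at x) v
      - frechet_derivative (\<lambda>y. g y u v) (at x) w) / 2)"

definition geodesic_in_coordinates ::
  "'a::real_normed_vector metric \<Rightarrow> real set \<Rightarrow> (real \<Rightarrow> 'a) \<Rightarrow> bool" where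
  "geodesic_in_coordinates g T x \<longleftrightarrow> (\<exists>x'. \<forall>t\<in>T.
     (x has_vector_derivative x' t) (at t) \<and>
     (x' has_vector_derivative - christoffel g (x t) (x' t) (x' t)) (at t))"

text \<open>A patch \<open>(X, D, g)\<close> is a parametrisation \<open>X\<close>, its open coordinate domain \<open>D\<close>, and the
  coordinate expression \<open>g\<close> of the metric. A manifold embedded in \<open>'b\<close> is given by a set of
  patches.\<close>
type_synonym ('a, 'b) patch = "('a \<Rightarrow> 'b) \<times> 'a set \<times> 'a metric"

definition tangent_bundle ::
  "('a::real_normed_vector, 'b::real_normed_vector) patch set \<Rightarrow> ('b \<times> 'b) set" where
  "tangent_bundle A = (\<Union>(X, D, g)\<in>A. tangent_map X ` (D \<times> UNIV))"

text \<open>Affinely parameterised geodesics on an interval \<open>J\<close>: near every time the curve is the image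
  of a solution of the geodesic equation in some patch.\<close>
definition geodesic ::
  "('a::real_normed_vector, 'b::real_normed_vector) patch set \<Rightarrow> real set \<Rightarrow> (real \<Rightarrow> 'b) \<Rightarrow> bool" where
  "geodesic A J \<gamma> \<longleftrightarrow> open J \<and> is_interval J \<and>
     (\<forall>t\<in>J. \<exists>(X, D, g)\<in>A. \<exists>T x. open T \<and> t \<in> T \<and> T \<subseteq> J \<and>
        (\<forall>s\<in>T. x s \<in> D \<and> \<gamma> s = X (x s)) \<and> geodesic_in_coordinates g T x)"

text \<open>Functions on the tangent bundle are total functions on \<open>'b \<times> 'b\<close>; only their values on
  \<open>tangent_bundle A\<close> matter.\<close>
definition first_integral ::
  "('a::real_normed_vector, 'b::real_normed_vector) patch set \<Rightarrow> ('b \<times> 'b \<Rightarrow> real) \<Rightarrow> bool" where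
  "first_integral A F \<longleftrightarrow>
     (\<forall>(X, D, g)\<in>A. smooth_on (D \<times> UNIV) (F \<circ> tangent_map X)) \<and>
     (\<forall>J \<gamma>. geodesic A J \<gamma> \<longrightarrow>
        (\<forall>s\<in>J. \<forall>t\<in>J. F (\<gamma> s, vector_derivative \<gamma> (at s)) = F (\<gamma> t, vector_derivative \<gamma> (at t))))"

text \<open>Covectors on \<open>'a\<close> are represented by vectors through the Euclidean inner product of the
  coordinate space, so that \<open>legendre g\<close> is $(x,v)\mapsto(x,g_x(v,\cdot))$ and \<open>canonical_bracket\<close>
  is $\sum_i \partial_{x^i}F\,\partial_{p_i}H-\partial_{p_i}F\,\partial_{x^i}H$.\<close>
definition legendre :: "'a::euclidean_space metric \<Rightarrow> 'a \<times> 'a \<Rightarrow> 'a \<times> 'a" where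
  "legendre g = (\<lambda>(x, v). (x, \<Sum>b\<in>Basis. g x v b *\<^sub>R b))"

definition legendre_inv :: "'a::euclidean_space metric \<Rightarrow> 'a \<times> 'a \<Rightarrow> 'a \<times> 'a" where
  "legendre_inv g = (\<lambda>(x, p). (x, THE v. legendre g (x, v) = (x, p)))"

definition canonical_bracket ::
  "('a::euclidean_space \<times> 'a \<Rightarrow> real) \<Rightarrow> ('a \<times> 'a \<Rightarrow> real) \<Rightarrow> 'a \<times> 'a \<Rightarrow> real" where
  "canonical_bracket F H z = (\<Sum>b\<in>Basis.
     frechet_derivative F (at z) (b, 0) * frechet_derivative H (at z) (0, b)
     - frechet_derivative F (at z) (0, b) * frechet_derivative H (at z) (b, 0))"

text \<open>The Poisson bracket on the tangent bundle is the canonical bracket of the cotangent bundle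
  transported by the Legendre transformation of the metric.\<close>
definition poisson_bracket ::
  "'a::euclidean_space metric \<Rightarrow> ('a \<times> 'a \<Rightarrow> real) \<Rightarrow> ('a \<times> 'a \<Rightarrow> real) \<Rightarrow> 'a \<times> 'a \<Rightarrow> real" where
  "poisson_bracket g F H z =
     canonical_bracket (F \<circ> legendre_inv g) (H \<circ> legendre_inv g) (legendre g z)"

definition poisson_commute ::
  "('a::euclidean_space, 'b::real_normed_vector) patch set \<Rightarrow> ('b \<times> 'b \<Rightarrow> real) \<Rightarrow> ('b \<times> 'b \<Rightarrow> real) \<Rightarrow> bool" where
  "poisson_commute A F H \<longleftrightarrow> (\<forall>(X, D, g)\<in>A. \<forall>z\<in>D \<times> UNIV.
     poisson_bracket g (F \<circ> tangent_map X) (H \<circ> tangent_map X) z = 0)"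

definition functionally_independent_on ::
  "('a::real_normed_vector, 'b::real_normed_vector) patch set \<Rightarrow> ('b \<times> 'b) set \<Rightarrow>
    ('b \<times> 'b \<Rightarrow> real) \<Rightarrow> ('b \<times> 'b \<Rightarrow> real) \<Rightarrow> bool" where
  "functionally_independent_on A U F H \<longleftrightarrow>
     (\<forall>(X, D, g)\<in>A. \<forall>z\<in>D \<times> UNIV. tangent_map X z \<in> U \<longrightarrow>
        (\<forall>a b. (\<forall>w. a * frechet_derivative (F \<circ> tangent_map X) (at z) w
                   + b * frechet_derivative (H \<circ> tangent_map X) (at z) w = 0)
               \<longrightarrow> a = 0 \<and> b = 0))"

text \<open>Complete integrability of the geodesic flow of a surface (hence two integrals).\<close>
definition completely_integrable_with ::
  "(complex, 'b::real_normed_vector) patch set \<Rightarrow> ('b \<times> 'b \<Rightarrow> real) \<Rightarrow> ('b \<times> 'b \<Rightarrow> real) \<Rightarrow> bool" where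
  "completely_integrable_with A F H \<longleftrightarrow>
     first_integral A F \<and> first_integral A H \<and> poisson_commute A F H \<and>
     (\<exists>U. openin (top_of_set (tangent_bundle A)) U \<and> tangent_bundle A \<subseteq> closure U \<and>
          functionally_independent_on A U F H)"


section \<open>The space of oriented lines\<close>

text \<open>Stereographic projection of the unit sphere from the south pole, $\xi=(p_1+ip_2)/(1+p_3)$,
  and the complementary holomorphic coordinate $1/\xi$ centred at the south pole.\<close>

definition stereo_N :: "real^3 \<Rightarrow> complex" where
  "stereo_N p = Complex (p $ 1) (p $ 2) / of_real (1 + p $ 3)"

definition stereo_S :: "real^3 \<Rightarrow> complex" where
  "stereo_S p = Complex (p $ 1) (- (p $ 2)) / of_real (1 - p $ 3)"

definition sphere_N :: "complex \<Rightarrow> real^3" where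
  "sphere_N x = (1 / (1 + (cmod x)\<^sup>2)) *\<^sub>R vector [2 * Re x, 2 * Im x, 1 - (cmod x)\<^sup>2]"

definition sphere_S :: "complex \<Rightarrow> real^3" where
  "sphere_S y = (1 / (1 + (cmod y)\<^sup>2)) *\<^sub>R vector [2 * Re y, - 2 * Im y, (cmod y)\<^sup>2 - 1]"

text \<open>The space of oriented lines is \<open>TS\<^sup>2 = {(p, v). norm p = 1 \<and> p \<bullet> v = 0}\<close> inside
  \<open>\<real>\<^sup>3 \<times> \<real>\<^sup>3\<close>. The line with coordinates $(\xi,\eta)$ is the real tangent vector
  $\eta\,\partial_\xi+\bar\eta\,\partial_{\bar\xi}$ at the point $\xi$, which is the image of \<open>\<eta>\<close>
  under the real differential of the parametrisation of the sphere.\<close>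

definition line_N :: "complex \<times> complex \<Rightarrow> (real^3) \<times> (real^3)" where
  "line_N = tangent_map sphere_N"

definition line_S :: "complex \<times> complex \<Rightarrow> (real^3) \<times> (real^3)" where
  "line_S = tangent_map sphere_S"

text \<open>Symmetrised tensor product of two 1-forms, evaluated on two vectors.\<close>
definition sym_prod :: "('a \<Rightarrow> complex) \<Rightarrow> ('a \<Rightarrow> complex) \<Rightarrow> 'a \<Rightarrow> 'a \<Rightarrow> complex" where
  "sym_prod \<alpha> \<beta> a b = (\<alpha> a * \<beta> b + \<beta> a * \<alpha> b) / 2"

text \<open>The neutral metric in the coordinates $(\xi,\eta)$. A tangent vector is a pair
  $(\dot\xi,\dot\eta)$; the 1-forms $d\xi, d\bar\xi, d\eta, d\bar\eta$ are the four functions of it below.\<close>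
definition neutral_form ::
  "complex \<times> complex \<Rightarrow> complex \<times> complex \<Rightarrow> complex \<times> complex \<Rightarrow> complex" where
  "neutral_form = (\<lambda>(\<xi>, \<eta>) a b.
     let d\<xi> = fst; d\<xi>' = (\<lambda>a. cnj (fst a)); d\<eta> = snd; d\<eta>' = (\<lambda>a. cnj (snd a)) in
     2 * \<i> / (1 + \<xi> * cnj \<xi>)\<^sup>2 *
       (sym_prod d\<eta> d\<xi>' a b - sym_prod d\<eta>' d\<xi> a b
        + 2 * (\<xi> * cnj \<eta> - cnj \<xi> * \<eta>) / (1 + \<xi> * cnj \<xi>) * sym_prod d\<xi> d\<xi>' a b))"

lemma one_plus_cnj_nz: "1 + x * cnj x \<noteq> 0"
proof -
  have "1 + x * cnj x = of_real (1 + (cmod x)\<^sup>2)"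
    by (simp only: of_real_add of_real_1 complex_norm_square)
  moreover have "1 + (cmod x)\<^sup>2 \<noteq> 0"
    using zero_le_power2[of "cmod x"] by linarith
  ultimately show ?thesis by (metis of_real_eq_0_iff)
qed

lemma Im_neutral_form: "Im (neutral_form z a b) = 0"
proof -
  obtain x y where z: "z = (x, y)" by (cases z)
  obtain a1 a2 where a: "a = (a1, a2)" by (cases a)
  obtain b1 b2 where b: "b = (b1, b2)" by (cases b)
  define N where "N = 1 + x * cnj x"
  define P where "P = a2 * cnj b1 + cnj a1 * b2"
  define R where "R = x * cnj y - cnj x * y"
  define S where "S = a1 * cnj b1 + cnj a1 * b1"
  have N: "cnj N = N" and R: "cnj R = - R" and S: "cnj S = S"
    by (simp_all add: N_def R_def S_def mult.commute add.commute)
  have "neutral_form z a b = 2 * \<i> / N\<^sup>2 * (P / 2 - cnj P / 2 + 2 * R / N * (S / 2))"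
    by (simp add: z a b neutral_form_def sym_prod_def N_def P_def R_def S_def)
  moreover have "cnj (2 * \<i> / N\<^sup>2) = - (2 * \<i> / N\<^sup>2)"
    by (simp add: N)
  moreover have "cnj (P / 2 - cnj P / 2 + 2 * R / N * (S / 2)) = - (P / 2 - cnj P / 2 + 2 * R / N * (S / 2))"
    by (simp add: N R S)
  ultimately have "cnj (neutral_form z a b) = neutral_form z a b"
    by (simp only: complex_cnj_mult minus_mult_minus)
  then show ?thesis by (metis Reals_cnj_iff complex_is_Real_iff)
qed

definition neutral_metric :: "(complex \<times> complex) metric" where
  "neutral_metric z a b = Re (neutral_form z a b)"

lemma sphere_S_inverse:
  assumes "x \<noteq> 0"
  shows "sphere_S (inverse x) = sphere_N x"
proof -
  have n: "(cmod x)\<^sup>2 \<noteq> 0" "1 + (cmod x)\<^sup>2 \<noteq> 0"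
    using assms by (auto simp: add_nonneg_eq_0_iff)
  have r: "Re (inverse x) = Re x / (cmod x)\<^sup>2" "Im (inverse x) = - Im x / (cmod x)\<^sup>2"
    by (simp_all add: cmod_power2)
  have m: "(cmod (inverse x))\<^sup>2 = 1 / (cmod x)\<^sup>2"
    by (simp add: norm_inverse power_inverse divide_inverse)
  show ?thesis
    unfolding sphere_S_def sphere_N_def r m vec_eq_iff forall_3
    using n by (simp add: divide_simps)
qed

text \<open>The coordinate change to the chart around the south pole is the tangent map of
  $\xi\mapsto 1/\xi$, and the metric has the same expression in both charts.\<close>

lemma tangent_map_inverse:
  "x \<noteq> 0 \<Longrightarrow> tangent_map inverse (x :: complex, u) = (inverse x, - u / x\<^sup>2)"
proof -
  assume "x \<noteq> 0"
  then have "(inverse has_derivative (\<lambda>u. - (inverse x * u * inverse x))) (at x)"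
    by (rule has_derivative_inverse')
  from frechet_derivative_at[OF this, symmetric] show ?thesis
    by (simp add: tangent_map_def power2_eq_square divide_inverse mult_ac)
qed

lemma neutral_metric_transition:
  assumes "\<xi> \<noteq> 0"
  shows "pullback (tangent_map inverse) neutral_metric (\<xi>, \<eta>) = neutral_metric (\<xi>, \<eta>)"
proof -
  have "((\<lambda>(x, u). (inverse x, - u / x\<^sup>2)) has_derivative
      (\<lambda>(a, b). (- a / \<xi>\<^sup>2, - b / \<xi>\<^sup>2 + 2 * \<eta> * a / \<xi> ^ 3))) (at (\<xi>, \<eta>))"
    unfolding case_prod_beta
    by (rule derivative_eq_intros refl | simp add: assms)+
       (auto simp: fun_eq_iff assms field_simps power2_eq_square power3_eq_cube)
  then have "(tangent_map inverse has_derivative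
      (\<lambda>(a, b). (- a / \<xi>\<^sup>2, - b / \<xi>\<^sup>2 + 2 * \<eta> * a / \<xi> ^ 3))) (at (\<xi>, \<eta>))"
  proof (rule has_derivative_transform_within_open)
    show "open ((- {0 :: complex}) \<times> (UNIV :: complex set))"
      by (intro open_Times open_Compl) auto
    show "(\<xi>, \<eta>) \<in> (- {0}) \<times> UNIV" using assms by simp
  next
    fix z :: "complex \<times> complex"
    assume "z \<in> (- {0}) \<times> UNIV"
    then show "(\<lambda>(x, u). (inverse x, - u / x\<^sup>2)) z = tangent_map inverse z"
      using tangent_map_inverse[of "fst z" "snd z"] by (cases z) simp
  qed
  note D = frechet_derivative_at[OF this, symmetric]
  have "neutral_form (tangent_map inverse (\<xi>, \<eta>))
      (frechet_derivative (tangent_map inverse) (at (\<xi>, \<eta>)) a)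
      (frechet_derivative (tangent_map inverse) (at (\<xi>, \<eta>)) b) = neutral_form (\<xi>, \<eta>) a b" for a b
  proof -
    obtain a1 a2 where a: "a = (a1, a2)" by (cases a)
    obtain b1 b2 where b: "b = (b1, b2)" by (cases b)
    have key: "2 * \<i> / (1 + inverse x * inverse x')\<^sup>2 *
       (((- a2 / x\<^sup>2 + 2 * y * a1 / x ^ 3) * (- b1' / x'\<^sup>2) + (- a1' / x'\<^sup>2) * (- b2 / x\<^sup>2 + 2 * y * b1 / x ^ 3)) / 2
       - ((- a2' / x'\<^sup>2 + 2 * y' * a1' / x' ^ 3) * (- b1 / x\<^sup>2) + (- a1 / x\<^sup>2) * (- b2' / x'\<^sup>2 + 2 * y' * b1' / x' ^ 3)) / 2
       + 2 * (inverse x * (- y' / x'\<^sup>2) - inverse x' * (- y / x\<^sup>2)) / (1 + inverse x * inverse x')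
         * (((- a1 / x\<^sup>2) * (- b1' / x'\<^sup>2) + (- a1' / x'\<^sup>2) * (- b1 / x\<^sup>2)) / 2))
     = 2 * \<i> / (1 + x * x')\<^sup>2 *
       ((a2 * b1' + a1' * b2) / 2 - (a2' * b1 + a1 * b2') / 2
       + 2 * (x * y' - x' * y) / (1 + x * x') * ((a1 * b1' + a1' * b1) / 2))"
      if "x \<noteq> 0" "x' \<noteq> 0" "1 + x * x' \<noteq> 0" for x x' y y' a1' a2' b1' b2' :: complex
    proof -
      define N where "N = 1 + x * x'"
      have N: "1 + inverse x * inverse x' = N / (x * x')" "N \<noteq> 0"
        using that by (auto simp: field_simps N_def)
      have M: "1 + x * x' = N" by (simp add: N_def)
      have *: "N = 1 + x * x'" by (simp add: N_def)
      show ?thesis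
        unfolding N(1) M using that(1,2) N(2)
        apply (simp add: divide_simps)
        apply (simp add: *)
        apply algebra
        done
    qed
    show ?thesis
      unfolding D a b tangent_map_inverse[OF assms] neutral_form_def Let_def sym_prod_def
      using key[of \<xi> "cnj \<xi>" \<eta> "cnj b1" "cnj a1" "cnj a2" "cnj \<eta>" "cnj b2"] assms one_plus_cnj_nz[of \<xi>] by (simp add: mult_ac)
  qed
  then show ?thesis by (simp add: fun_eq_iff pullback_def neutral_metric_def)
qed


section \<open>The holomorphic sphere\<close>

text \<open>The section $\xi\mapsto(\xi,ci\xi)$; in the chart around the south pole it becomes
  the same section with \<open>- c\<close> for \<open>c\<close>.\<close>
definition hol_section :: "real \<Rightarrow> complex \<Rightarrow> complex \<times> complex" where
  "hol_section c \<xi> = (\<xi>, of_real c * \<i> * \<xi>)"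

lemma hol_section_transition:
  "\<xi> \<noteq> 0 \<Longrightarrow> tangent_map inverse (hol_section c \<xi>) = hol_section (- c) (inverse \<xi>)"
  by (simp add: hol_section_def tangent_map_inverse power2_eq_square field_simps)

definition Sigma_N :: "real \<Rightarrow> complex \<Rightarrow> (real^3) \<times> (real^3)" where
  "Sigma_N c = line_N \<circ> hol_section c"

definition Sigma_S :: "real \<Rightarrow> complex \<Rightarrow> (real^3) \<times> (real^3)" where
  "Sigma_S c = line_S \<circ> hol_section (- c)"

definition metric_N :: "real \<Rightarrow> complex metric" where
  "metric_N c = pullback (hol_section c) neutral_metric"

definition metric_S :: "real \<Rightarrow> complex metric" where
  "metric_S c = pullback (hol_section (- c)) neutral_metric"

lemma metric_N_eq:
  "metric_N c \<xi> u v =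
     - (4 * c * (1 - (cmod \<xi>)\<^sup>2) / (1 + (cmod \<xi>)\<^sup>2) ^ 3) * Re (u * cnj v)"
proof -
  have "(hol_section c has_derivative (\<lambda>u. (u, of_real c * \<i> * u))) (at \<xi>)"
    unfolding hol_section_def by (auto intro!: derivative_eq_intros)
  note D = frechet_derivative_at[OF this, symmetric]
  define N where "N = 1 + \<xi> * cnj \<xi>"
  have N: "N \<noteq> 0" "\<xi> * cnj \<xi> = N - 1" using one_plus_cnj_nz by (simp_all add: N_def)
  have "neutral_form (hol_section c \<xi>) (u, of_real c * \<i> * u) (v, of_real c * \<i> * v)
    = - 4 * c * (1 - \<xi> * cnj \<xi>) / N ^ 3 * ((u * cnj v + cnj u * v) / 2)"
    unfolding neutral_form_def hol_section_def Let_def sym_prod_def prod.case N_def[symmetric]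
    using N(1)
    apply (simp add: field_simps power2_eq_square power3_eq_cube)
    using N(2) i_squared
    apply algebra
    done
  also have "(u * cnj v + cnj u * v) / 2 = of_real (Re (u * cnj v))"
    by (simp add: complex_eq_iff)
  also have "\<xi> * cnj \<xi> = of_real ((cmod \<xi>)\<^sup>2)" by (simp only: complex_norm_square)
  also have "N = of_real (1 + (cmod \<xi>)\<^sup>2)"
    by (simp only: N_def of_real_add of_real_1 complex_norm_square)
  also have "of_real (- 4 * c) * (1 - of_real ((cmod \<xi>)\<^sup>2)) / of_real (1 + (cmod \<xi>)\<^sup>2) ^ 3 * of_real (Re (u * cnj v))
    = (of_real (- (4 * c * (1 - (cmod \<xi>)\<^sup>2) / (1 + (cmod \<xi>)\<^sup>2) ^ 3) * Re (u * cnj v)) :: complex)"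
    by simp
  finally show ?thesis
    unfolding metric_N_def pullback_def D neutral_metric_def by (simp only: Re_complex_of_real)
qed

text \<open>The sphere without the equator, on which the induced metric degenerates. The two patches
  together cover both poles.\<close>
definition Sigma_patches :: "real \<Rightarrow> (complex, (real^3) \<times> (real^3)) patch set" where
  "Sigma_patches c =
     {(Sigma_N c, {\<xi>. cmod \<xi> \<noteq> 1}, metric_N c), (Sigma_S c, {\<xi>. cmod \<xi> \<noteq> 1}, metric_S c)}"

lemma tangent_map_cong:
  assumes "open S" "x \<in> S" "\<And>y. y \<in> S \<Longrightarrow> f y = g y"
  shows "tangent_map f (x, u) = tangent_map g (x, u)"
proof -
  have "(f has_derivative f') (at x) \<longleftrightarrow> (g has_derivative f') (at x)" for f'
    using has_derivative_transform_within_open[of f f' x UNIV S g]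
      has_derivative_transform_within_open[of g f' x UNIV S f] assms by auto
  then show ?thesis using assms by (simp add: tangent_map_def frechet_derivative_def)
qed

lemma tangent_map_comp:
  assumes "g differentiable at x" "f differentiable at (g x)"
  shows "tangent_map (f \<circ> g) (x, u) = tangent_map f (tangent_map g (x, u))"
proof -
  have "(f \<circ> g has_derivative frechet_derivative f (at (g x)) \<circ> frechet_derivative g (at x)) (at x)"
    using assms by (intro diff_chain_at) (simp_all add: frechet_derivative_works[symmetric])
  from frechet_derivative_at[OF this, symmetric] show ?thesis
    by (simp add: tangent_map_def)
qed

lemma vector_3_axis:
  "(vector [a, b, c] :: real^3) = a *\<^sub>R axis 1 1 + b *\<^sub>R axis 2 1 + c *\<^sub>R axis 3 1"
  by (simp add: vec_eq_iff forall_3 axis_def)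

lemma one_plus_inner_nz: "1 + x \<bullet> x \<noteq> 0" for x :: complex
  using inner_ge_zero[of x] by linarith

lemma sphere_N_has_derivative:
  "(sphere_N has_derivative (\<lambda>u.
     (1 / (1 + x \<bullet> x)) *\<^sub>R ((2 * Re u) *\<^sub>R axis 1 1 + (2 * Im u) *\<^sub>R axis 2 1 + (- 2 * (x \<bullet> u)) *\<^sub>R axis 3 1)
     + (- 2 * (x \<bullet> u) / (1 + x \<bullet> x)\<^sup>2) *\<^sub>R
       ((2 * Re x) *\<^sub>R axis 1 1 + (2 * Im x) *\<^sub>R axis 2 1 + (1 - x \<bullet> x) *\<^sub>R axis 3 1))) (at x)"
  unfolding sphere_N_def vector_3_axis power2_norm_eq_inner
  by (rule derivative_eq_intros refl one_plus_inner_nz)+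
     (simp add: fun_eq_iff inner_commute power2_eq_square divide_inverse mult_ac)

lemma sphere_S_has_derivative:
  "(sphere_S has_derivative (\<lambda>u.
     (1 / (1 + x \<bullet> x)) *\<^sub>R ((2 * Re u) *\<^sub>R axis 1 1 + (- 2 * Im u) *\<^sub>R axis 2 1 + (2 * (x \<bullet> u)) *\<^sub>R axis 3 1)
     + (- 2 * (x \<bullet> u) / (1 + x \<bullet> x)\<^sup>2) *\<^sub>R
       ((2 * Re x) *\<^sub>R axis 1 1 + (- 2 * Im x) *\<^sub>R axis 2 1 + (x \<bullet> x - 1) *\<^sub>R axis 3 1))) (at x)"
  unfolding sphere_S_def vector_3_axis power2_norm_eq_inner
  by (rule derivative_eq_intros refl one_plus_inner_nz)+
     (simp add: fun_eq_iff inner_commute power2_eq_square divide_inverse mult_ac)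

lemma sphere_N_differentiable: "sphere_N differentiable at x"
  by (rule differentiableI[OF sphere_N_has_derivative])

lemma sphere_S_differentiable: "sphere_S differentiable at x"
  by (rule differentiableI[OF sphere_S_has_derivative])

lemma Re_Im_differentiable:
  assumes "f differentiable at x"
  shows "(\<lambda>y. Re (f y)) differentiable at x" "(\<lambda>y. Im (f y)) differentiable at x"
  using assms unfolding differentiable_def by (blast intro: has_derivative_Re has_derivative_Im)+

lemma Sigma_N_differentiable: "Sigma_N c differentiable at x"
  unfolding Sigma_N_def line_N_def hol_section_def comp_def tangent_map_def prod.case
    frechet_derivative_at[OF sphere_N_has_derivative, symmetric]
  by (intro differentiable_Pair differentiable_add differentiable_scaleR differentiable_divide
      differentiable_mult differentiable_diff differentiable_power differentiable_inner
      Re_Im_differentiable sphere_N_differentiable differentiable_const differentiable_ident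
      power_not_zero one_plus_inner_nz)

lemma Sigma_S_differentiable: "Sigma_S c differentiable at x"
  unfolding Sigma_S_def line_S_def hol_section_def comp_def tangent_map_def prod.case
    frechet_derivative_at[OF sphere_S_has_derivative, symmetric]
  by (intro differentiable_Pair differentiable_add differentiable_scaleR differentiable_divide
      differentiable_mult differentiable_diff differentiable_power differentiable_inner
      Re_Im_differentiable sphere_S_differentiable differentiable_const differentiable_ident
      power_not_zero one_plus_inner_nz)

lemma Sigma_S_inverse: "\<xi> \<noteq> 0 \<Longrightarrow> Sigma_S c (inverse \<xi>) = Sigma_N c \<xi>"
proof -
  assume nz: "\<xi> \<noteq> 0"
  have "tangent_map sphere_N (\<xi>, u) = tangent_map (sphere_S \<circ> inverse) (\<xi>, u)" for u
    by (rule tangent_map_cong[of "- {0}"]) (use nz in \<open>auto simp: sphere_S_inverse\<close>)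
  also have "tangent_map (sphere_S \<circ> inverse) (\<xi>, u) = tangent_map sphere_S (tangent_map inverse (\<xi>, u))" for u
    using nz by (intro tangent_map_comp differentiable_inverse sphere_S_differentiable) auto
  finally have "tangent_map sphere_N (hol_section c \<xi>)
      = tangent_map sphere_S (tangent_map inverse (hol_section c \<xi>))"
    by (simp add: hol_section_def)
  then show ?thesis
    using nz by (simp add: Sigma_N_def Sigma_S_def line_N_def line_S_def hol_section_transition)
qed


section \<open>The two integrals\<close>

definition I1_coord :: "complex \<times> complex \<Rightarrow> real" where
  "I1_coord = (\<lambda>(\<xi>, \<xi>').
     Re ((1 - \<xi> * cnj \<xi>) / (1 + \<xi> * cnj \<xi>) ^ 3 * (\<xi>' * cnj \<xi>')))"

definition I2_coord :: "complex \<times> complex \<Rightarrow> real" where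
  "I2_coord = (\<lambda>(\<xi>, \<xi>').
     Re ((1 - \<xi> * cnj \<xi>) / (2 * \<i> * (1 + \<xi> * cnj \<xi>) ^ 3) * (cnj \<xi> * \<xi>' - \<xi> * cnj \<xi>')))"

text \<open>Under $\xi\mapsto1/\xi$ the first expression changes sign and the second one is invariant.
  This extends both functions smoothly over the fibre above the south pole.\<close>

lemma I1_coord_transition:
  "\<xi> \<noteq> 0 \<Longrightarrow> I1_coord (tangent_map inverse (\<xi>, u)) = - I1_coord (\<xi>, u)"
proof -
  assume nz: "\<xi> \<noteq> 0"
  define N where "N = 1 + \<xi> * cnj \<xi>"
  have N: "N \<noteq> 0" "1 + inverse \<xi> * inverse (cnj \<xi>) = N / (\<xi> * cnj \<xi>)"
    using one_plus_cnj_nz nz by (auto simp: N_def field_simps)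
  have M: "1 + \<xi> * cnj \<xi> = N" by (simp add: N_def)
  have "(1 - inverse \<xi> * inverse (cnj \<xi>)) / (1 + inverse \<xi> * inverse (cnj \<xi>)) ^ 3
      * ((- u / \<xi>\<^sup>2) * (- cnj u / (cnj \<xi>)\<^sup>2))
     = - ((1 - \<xi> * cnj \<xi>) / (1 + \<xi> * cnj \<xi>) ^ 3 * (u * cnj u))"
    unfolding N(2) M using nz N(1)
    by (simp add: divide_simps) algebra
  then show ?thesis
    by (simp add: I1_coord_def tangent_map_inverse nz mult_ac flip: uminus_complex.sel(1))
qed

lemma I2_coord_transition:
  "\<xi> \<noteq> 0 \<Longrightarrow> I2_coord (tangent_map inverse (\<xi>, u)) = I2_coord (\<xi>, u)"
proof -
  assume nz: "\<xi> \<noteq> 0"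
  define N where "N = 1 + \<xi> * cnj \<xi>"
  have N: "N \<noteq> 0" "1 + inverse \<xi> * inverse (cnj \<xi>) = N / (\<xi> * cnj \<xi>)"
    using one_plus_cnj_nz nz by (auto simp: N_def field_simps)
  have M: "1 + \<xi> * cnj \<xi> = N" by (simp add: N_def)
  have "(1 - inverse \<xi> * inverse (cnj \<xi>)) / (2 * \<i> * (1 + inverse \<xi> * inverse (cnj \<xi>)) ^ 3)
      * (inverse (cnj \<xi>) * (- u / \<xi>\<^sup>2) - inverse \<xi> * (- cnj u / (cnj \<xi>)\<^sup>2))
     = (1 - \<xi> * cnj \<xi>) / (2 * \<i> * (1 + \<xi> * cnj \<xi>) ^ 3) * (cnj \<xi> * u - \<xi> * cnj u)"
    unfolding N(2) M using nz N(1)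
    by (simp add: divide_simps) algebra
  then show ?thesis
    by (simp add: I2_coord_def tangent_map_inverse nz)
qed

text \<open>A vector tangent to the sphere of lines is \<open>((p, v), (p', v'))\<close>; its coordinates
  $(\xi,\dot\xi)$ are the stereographic coordinates of \<open>(p, p')\<close>.\<close>

definition I1 :: "((real^3) \<times> (real^3)) \<times> ((real^3) \<times> (real^3)) \<Rightarrow> real" where
  "I1 = (\<lambda>((p, v), (p', v')).
     if p $ 3 \<noteq> - 1 then I1_coord (tangent_map stereo_N (p, p'))
     else - I1_coord (tangent_map stereo_S (p, p')))"

definition I2 :: "((real^3) \<times> (real^3)) \<times> ((real^3) \<times> (real^3)) \<Rightarrow> real" where
  "I2 = (\<lambda>((p, v), (p', v')).
     if p $ 3 \<noteq> - 1 then I2_coord (tangent_map stereo_N (p, p'))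
     else I2_coord (tangent_map stereo_S (p, p')))"

lemma stereo_N_sphere_N: "stereo_N (sphere_N x) = x"
  and sphere_N_3: "sphere_N x $ 3 \<noteq> - 1"
  using one_plus_inner_nz[of x]
  by (auto simp: stereo_N_def sphere_N_def complex_eq_iff power2_norm_eq_inner divide_simps)

lemma stereo_S_sphere_S: "stereo_S (sphere_S x) = x"
  and sphere_S_3: "sphere_S x $ 3 \<noteq> 1"
  using one_plus_inner_nz[of x]
  by (auto simp: stereo_S_def sphere_S_def complex_eq_iff power2_norm_eq_inner divide_simps)

lemma stereo_N_differentiable: "p $ 3 \<noteq> - 1 \<Longrightarrow> stereo_N differentiable at p"
  unfolding stereo_N_def Complex_eq differentiable_def
  by (rule exI, (rule derivative_intros bounded_linear.has_derivative[OF bounded_linear_vec_nth]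
        | simp add: complex_eq_iff add_eq_0_iff)+)

lemma stereo_S_differentiable: "p $ 3 \<noteq> 1 \<Longrightarrow> stereo_S differentiable at p"
  unfolding stereo_S_def Complex_eq differentiable_def
  by (rule exI, (rule derivative_intros bounded_linear.has_derivative[OF bounded_linear_vec_nth]
        | simp add: complex_eq_iff)+)

lemma tangent_map_fst_comp:
  assumes "f differentiable at x" "fst \<circ> f = g"
  shows "(fst (fst (tangent_map f (x, u))), fst (snd (tangent_map f (x, u)))) = tangent_map g (x, u)"
proof -
  have "(fst \<circ> f has_derivative fst \<circ> frechet_derivative f (at x)) (at x)"
    using assms(1) by (intro diff_chain_at) (auto simp: frechet_derivative_works[symmetric] intro: derivative_intros)
  from frechet_derivative_at[OF this, symmetric] show ?thesis
    using assms(2) by (auto simp: tangent_map_def)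
qed

lemma tangent_map_id: "tangent_map (\<lambda>x. x) z = z"
  by (simp add: tangent_map_def case_prod_beta frechet_derivative_at[OF has_derivative_ident, symmetric])

lemma fst_Sigma: "fst \<circ> Sigma_N c = sphere_N" "fst \<circ> Sigma_S c = sphere_S"
  by (auto simp: fun_eq_iff Sigma_N_def Sigma_S_def line_N_def line_S_def tangent_map_def hol_section_def)

lemma I_Sigma_N_aux:
  "fst (fst (tangent_map (Sigma_N c) (x, u))) $ 3 \<noteq> - 1"
  "tangent_map stereo_N (fst (fst (tangent_map (Sigma_N c) (x, u))),
     fst (snd (tangent_map (Sigma_N c) (x, u)))) = (x, u)"
proof -
  note 1 = tangent_map_fst_comp[OF Sigma_N_differentiable fst_Sigma(1), of c x u]
  have "tangent_map stereo_N (tangent_map sphere_N (x, u)) = tangent_map (stereo_N \<circ> sphere_N) (x, u)"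
    by (intro tangent_map_comp[symmetric] sphere_N_differentiable stereo_N_differentiable sphere_N_3)
  also have "stereo_N \<circ> sphere_N = (\<lambda>x. x)"
    by (simp add: fun_eq_iff stereo_N_sphere_N)
  finally show "tangent_map stereo_N (fst (fst (tangent_map (Sigma_N c) (x, u))),
     fst (snd (tangent_map (Sigma_N c) (x, u)))) = (x, u)"
    by (simp add: 1 tangent_map_id)
  show "fst (fst (tangent_map (Sigma_N c) (x, u))) $ 3 \<noteq> - 1"
    using 1 sphere_N_3[of x] by (simp add: tangent_map_def)
qed

lemma I_Sigma_S_aux:
  "tangent_map stereo_S (fst (fst (tangent_map (Sigma_S c) (x, u))),
     fst (snd (tangent_map (Sigma_S c) (x, u)))) = (x, u)"
proof -
  note 1 = tangent_map_fst_comp[OF Sigma_S_differentiable fst_Sigma(2), of c x u]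
  have "tangent_map stereo_S (tangent_map sphere_S (x, u)) = tangent_map (stereo_S \<circ> sphere_S) (x, u)"
    by (intro tangent_map_comp[symmetric] sphere_S_differentiable stereo_S_differentiable sphere_S_3)
  also have "stereo_S \<circ> sphere_S = (\<lambda>x. x)"
    by (simp add: fun_eq_iff stereo_S_sphere_S)
  finally show ?thesis
    by (simp add: 1 tangent_map_id)
qed

lemma Sigma_S_at_0: "fst (fst (tangent_map (Sigma_S c) (0, u))) $ 3 = - 1"
  using tangent_map_fst_comp[OF Sigma_S_differentiable fst_Sigma(2), of c 0 u]
  by (simp add: tangent_map_def sphere_S_def)

lemma tangent_map_Sigma_S:
  assumes "x \<noteq> 0"
  shows "tangent_map (Sigma_S c) (x, u) = tangent_map (Sigma_N c) (tangent_map inverse (x, u))"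
proof -
  have "tangent_map (Sigma_S c) (x, u) = tangent_map (Sigma_N c \<circ> inverse) (x, u)"
    by (rule tangent_map_cong[of "- {0}"])
       (use assms Sigma_S_inverse[of "inverse y" c for y] in auto)
  also have "\<dots> = tangent_map (Sigma_N c) (tangent_map inverse (x, u))"
    using assms by (intro tangent_map_comp differentiable_inverse Sigma_N_differentiable) auto
  finally show ?thesis .
qed

lemma I1_Sigma_N: "I1 (tangent_map (Sigma_N c) z) = I1_coord z"
  using I_Sigma_N_aux by (cases z) (auto simp: I1_def case_prod_beta)

lemma I2_Sigma_N: "I2 (tangent_map (Sigma_N c) z) = I2_coord z"
  using I_Sigma_N_aux by (cases z) (auto simp: I2_def case_prod_beta)

lemma I1_Sigma_S: "I1 (tangent_map (Sigma_S c) z) = - I1_coord z"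
proof -
  obtain x u where z: "z = (x, u)" by (cases z)
  show ?thesis
  proof (cases "x = 0")
    case True
    then show ?thesis
      using I_Sigma_S_aux[of c x u] Sigma_S_at_0[of c u] by (simp add: z I1_def case_prod_beta)
  next
    case False
    then show ?thesis
      by (simp add: z tangent_map_Sigma_S I1_Sigma_N I1_coord_transition)
  qed
qed

lemma I2_Sigma_S: "I2 (tangent_map (Sigma_S c) z) = I2_coord z"
proof -
  obtain x u where z: "z = (x, u)" by (cases z)
  show ?thesis
  proof (cases "x = 0")
    case True
    then show ?thesis
      using I_Sigma_S_aux[of c x u] Sigma_S_at_0[of c u] by (simp add: z I2_def case_prod_beta)
  next
    case False
    then show ?thesis
      by (simp add: z tangent_map_Sigma_S I2_Sigma_N I2_coord_transition)
  qed
qed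

end

theory Submission
  imports Defs
begin

text \<open>In either stereographic coordinate the induced metric is conformally flat,
  $f(x)\,\langle u,v\rangle$, with a factor \<open>f\<close> that depends on \<open>x \<bullet> x\<close> alone. Up to constant
  factors $\mathrm I_1$ is its energy $f(x)\,\langle v,v\rangle$ and $\mathrm I_2$ is Clairaut's
  integral $f(x)\,\langle ix,v\rangle$, the momentum of the Killing field $x\mapsto ix$ of rotations
  about the axis through the poles. So energy and momentum are conserved for the usual reason:
  the factor \<open>f\<close> has a gradient \<open>G\<close> orthogonal to \<open>\<i> * x\<close>, and multiplication by \<open>\<i>\<close> is skew
  (\<open>energy_conserved\<close>, \<open>momentum_conserved\<close>). On the cotangent bundle the two functions become
  $\langle p,p\rangle/f(x)$ and $\langle ix,p\rangle$, up to constants. The second generates the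
  rotations, which preserve the first, whence the bracket vanishes
  (\<open>poisson_bracket_energy_momentum\<close>).

  Already the derivatives in the fibre direction, which are proportional to \<open>v\<close> and to \<open>\<i> * x\<close>, are
  independent wherever \<open>x \<bullet> v \<noteq> 0\<close> (\<open>energy_momentum_independent\<close>). This condition says that the
  height on the unit sphere of directions changes at a nonzero rate, so it does not depend on the
  patch and defines an open set. That the set is dense follows from the density of \<open>x \<bullet> v \<noteq> 0\<close> in
  coordinates and the continuity of the tangent maps of the parametrisations.\<close>

section \<open>Smoothness of rational functions\<close>

text \<open>A class of functions, defined on the whole space, that contains the coordinate expressions of both
  integrals and is closed under directional derivatives; its members are therefore smooth.\<close>

inductive rational :: "('a::real_normed_vector \<Rightarrow> real) \<Rightarrow> bool" where
  const: "rational (\<lambda>_. a)"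
| linear: "bounded_linear f \<Longrightarrow> rational f"
| add: "rational f \<Longrightarrow> rational g \<Longrightarrow> rational (\<lambda>x. f x + g x)"
| mult: "rational f \<Longrightarrow> rational g \<Longrightarrow> rational (\<lambda>x. f x * g x)"
| inverse: "rational f \<Longrightarrow> (\<And>x. f x \<noteq> 0) \<Longrightarrow> rational (\<lambda>x. inverse (f x))"

lemma rational_directional_derivative:
  assumes "rational f"
  shows "\<exists>f'. (\<forall>x. (f has_derivative f' x) (at x)) \<and> (\<forall>v. rational (\<lambda>x. f' x v))"
  using assms
proof induction
  case (const a)
  then show ?case by (intro exI[of _ "\<lambda>_ _. 0"]) (auto intro: rational.const)
next
  case (linear f)
  then show ?case
    by (intro exI[of _ "\<lambda>_. f"]) (auto intro: rational.const bounded_linear_imp_has_derivative)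
next
  case (add f g)
  then obtain f' g' where "\<forall>x. (f has_derivative f' x) (at x)" "\<forall>v. rational (\<lambda>x. f' x v)"
    "\<forall>x. (g has_derivative g' x) (at x)" "\<forall>v. rational (\<lambda>x. g' x v)" by blast
  then show ?case
    by (intro exI[of _ "\<lambda>x v. f' x v + g' x v"]) (auto intro: rational.add has_derivative_add)
next
  case (mult f g)
  then obtain f' g' where "\<forall>x. (f has_derivative f' x) (at x)" "\<forall>v. rational (\<lambda>x. f' x v)"
    "\<forall>x. (g has_derivative g' x) (at x)" "\<forall>v. rational (\<lambda>x. g' x v)" by blast
  moreover have "rational (\<lambda>x. f x * g' x v + f' x v * g x)" for v
    by (intro rational.add rational.mult mult.hyps) (use calculation in blast)+
  ultimately show ?case
    by (intro exI[of _ "\<lambda>x v. f x * g' x v + f' x v * g x"]) (auto intro: has_derivative_mult)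
next
  case (inverse f)
  then obtain f' where f': "\<forall>x. (f has_derivative f' x) (at x)" "\<forall>v. rational (\<lambda>x. f' x v)"
    by blast
  have "rational (\<lambda>x. - 1 * (inverse (f x) * f' x v * inverse (f x)))" for v
    by (intro rational.mult rational.inverse rational.const inverse.hyps f'(2)[rule_format])
  with f' inverse.hyps show ?case
    by (intro exI[of _ "\<lambda>x v. - (inverse (f x) * f' x v * inverse (f x))"])
       (auto intro: has_derivative_inverse)
qed

lemma rational_Ck_on: "rational f \<Longrightarrow> Ck_on k S f"
proof (induction k arbitrary: f)
  case (0 f)
  then show ?case
    using rational_directional_derivative[of f]
    by (auto intro!: continuous_at_imp_continuous_on dest: has_derivative_continuous)
next
  case (Suc k f)
  then obtain f' where f': "\<And>x. (f has_derivative f' x) (at x)" "\<And>v. rational (\<lambda>x. f' x v)"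
    using rational_directional_derivative by blast
  then show ?case
    using Suc.IH frechet_derivative_at[OF f'(1), symmetric]
    by (auto simp: differentiable_def)
qed

lemma rational_smooth_on: "rational f \<Longrightarrow> smooth_on S f"
  by (simp add: smooth_on_def rational_Ck_on)

lemma rational_inner_complex:
  fixes f g :: "'a::real_normed_vector \<Rightarrow> complex"
  assumes "bounded_linear f" "bounded_linear g"
  shows "rational (\<lambda>x. f x \<bullet> g x)"
  unfolding inner_complex_def
  by (intro rational.add rational.mult rational.linear
      bounded_linear_compose[OF bounded_linear_Re] bounded_linear_compose[OF bounded_linear_Im] assms)

section \<open>Geodesics of conformally flat metrics\<close>

definition conformal_metric :: "('a::real_inner \<Rightarrow> real) \<Rightarrow> 'a metric" where
  "conformal_metric f x u v = f x * (u \<bullet> v)"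

definition energy :: "('a::real_inner \<Rightarrow> real) \<Rightarrow> 'a \<times> 'a \<Rightarrow> real" where
  "energy f = (\<lambda>(x, v). f x * (v \<bullet> v))"

text \<open>The quantity conserved along geodesics when \<open>K\<close> is a Killing field of \<open>conformal_metric f\<close>.\<close>

definition momentum :: "('a::real_inner \<Rightarrow> 'a) \<Rightarrow> ('a \<Rightarrow> real) \<Rightarrow> 'a \<times> 'a \<Rightarrow> real" where
  "momentum K f = (\<lambda>(x, v). f x * (K x \<bullet> v))"

text \<open>The vector on the right lowers to the Christoffel symbols of the first kind of
  \<open>conformal_metric f\<close>, and lowering is injective where \<open>f\<close> does not vanish.\<close>

lemma christoffel_conformal:
  assumes f: "(f has_derivative (\<lambda>w. G \<bullet> w)) (at x)" and nz: "f x \<noteq> 0"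
  shows "christoffel (conformal_metric f) x u v =
    (1 / (2 * f x)) *\<^sub>R ((G \<bullet> u) *\<^sub>R v + (G \<bullet> v) *\<^sub>R u - (u \<bullet> v) *\<^sub>R G)" (is "_ = ?z")
proof -
  have "((\<lambda>y. conformal_metric f y a b) has_derivative (\<lambda>w. (G \<bullet> w) * (a \<bullet> b))) (at x)" for a b
    unfolding conformal_metric_def by (intro has_derivative_mult_left f)
  note D = frechet_derivative_at[OF this, symmetric]
  have z: "f x * (?z \<bullet> w) = ((G \<bullet> u) * (v \<bullet> w) + (G \<bullet> v) * (u \<bullet> w) - (G \<bullet> w) * (u \<bullet> v)) / 2" for w
    using nz by (simp add: inner_simps field_simps)
  show ?thesis
    unfolding christoffel_def D unfolding conformal_metric_def z[symmetric]
  proof (rule the_equality)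
    show "\<forall>w. f x * (?z \<bullet> w) = f x * (?z \<bullet> w)" by simp
  next
    fix z'
    assume "\<forall>w. f x * (z' \<bullet> w) = f x * (?z \<bullet> w)"
    with nz have "\<forall>w. z' \<bullet> w = ?z \<bullet> w" by (simp only: mult_cancel_left simp_thms)
    then show "z' = ?z" by (simp only: vector_eq_rdot)
  qed
qed

lemma energy_has_derivative:
  assumes "(f has_derivative (\<lambda>w. G \<bullet> w)) (at x)"
  shows "(energy f has_derivative (\<lambda>(w, z). (G \<bullet> w) * (v \<bullet> v) + 2 * f x * (v \<bullet> z))) (at (x, v))"
proof -
  have f: "((\<lambda>z. f (fst z)) has_derivative (\<lambda>w. G \<bullet> fst w)) (at (x, v))"
    by (rule has_derivative_compose[of fst fst _ _ f]) (use assms in \<open>auto intro: derivative_intros\<close>)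
  show ?thesis
    unfolding energy_def case_prod_beta
    by (rule derivative_eq_intros f refl)+ (simp add: fun_eq_iff inner_commute algebra_simps)
qed

lemma momentum_has_derivative:
  assumes "(f has_derivative (\<lambda>w. G \<bullet> w)) (at x)" and K: "bounded_linear K"
  shows "(momentum K f has_derivative
    (\<lambda>(w, z). (G \<bullet> w) * (K x \<bullet> v) + f x * (K w \<bullet> v + K x \<bullet> z))) (at (x, v))"
proof -
  have f: "((\<lambda>z. f (fst z)) has_derivative (\<lambda>w. G \<bullet> fst w)) (at (x, v))"
    by (rule has_derivative_compose[of fst fst _ _ f]) (use assms in \<open>auto intro: derivative_intros\<close>)
  show ?thesis
    unfolding momentum_def case_prod_beta
    by (rule derivative_eq_intros f bounded_linear.has_derivative[OF K] refl)+
       (simp add: fun_eq_iff algebra_simps)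
qed

text \<open>With $a=-\Gamma(v,v)=-\big(\langle G,v\rangle v-\tfrac12\langle v,v\rangle G\big)/f$ the term
  $2f\langle v,a\rangle$ equals $-\langle G,v\rangle\langle v,v\rangle$, which cancels the derivative of
  the factor \<open>f\<close> along the curve.\<close>

lemma energy_conserved:
  assumes x: "(x has_vector_derivative x' t) (at t)"
    and x': "(x' has_vector_derivative - christoffel (conformal_metric f) (x t) (x' t) (x' t)) (at t)"
    and f: "(f has_derivative (\<lambda>w. G \<bullet> w)) (at (x t))" and nz: "f (x t) \<noteq> 0"
  shows "((\<lambda>s. energy f (x s, x' s)) has_vector_derivative 0) (at t)"
proof -
  have "((\<lambda>s. (x s, x' s)) has_derivative
      (\<lambda>h. h *\<^sub>R (x' t, - christoffel (conformal_metric f) (x t) (x' t) (x' t)))) (at t)"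
    using has_vector_derivative_Pair[OF x x'] by (simp add: has_vector_derivative_def)
  from has_derivative_compose[OF this energy_has_derivative[OF f]]
  show ?thesis
    using nz unfolding has_vector_derivative_def christoffel_conformal[OF f nz]
    by (simp add: inner_simps field_simps inner_commute)
qed

text \<open>A skew linear field \<open>K\<close> tangent to the level sets of \<open>f\<close> is a Killing field, and this is the
  conservation law that belongs to it.\<close>

lemma momentum_conserved:
  assumes x: "(x has_vector_derivative x' t) (at t)"
    and x': "(x' has_vector_derivative - christoffel (conformal_metric f) (x t) (x' t) (x' t)) (at t)"
    and f: "(f has_derivative (\<lambda>w. G \<bullet> w)) (at (x t))" and nz: "f (x t) \<noteq> 0"
    and K: "bounded_linear K" "\<And>u. K u \<bullet> u = 0" and G: "G \<bullet> K (x t) = 0"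
  shows "((\<lambda>s. momentum K f (x s, x' s)) has_vector_derivative 0) (at t)"
proof -
  have "((\<lambda>s. (x s, x' s)) has_derivative
      (\<lambda>h. h *\<^sub>R (x' t, - christoffel (conformal_metric f) (x t) (x' t) (x' t)))) (at t)"
    using has_vector_derivative_Pair[OF x x'] by (simp add: has_vector_derivative_def)
  from has_derivative_compose[OF this momentum_has_derivative[OF f K(1)]]
  show ?thesis
    using nz G K(2) unfolding has_vector_derivative_def christoffel_conformal[OF f nz]
    by (simp add: inner_simps field_simps inner_commute linear_scale[OF bounded_linear.linear[OF K(1)]])
qed

section \<open>The Poisson bracket of energy and momentum\<close>

lemma legendre_conformal: "legendre (conformal_metric f) (x, v) = (x, f x *\<^sub>R v)"
  by (simp add: legendre_def conformal_metric_def euclidean_representation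
      flip: scaleR_scaleR scaleR_sum_right)

lemma legendre_inv_conformal:
  "f x \<noteq> 0 \<Longrightarrow> legendre_inv (conformal_metric f) (x, p) = (x, (1 / f x) *\<^sub>R p)"
  by (auto simp: legendre_inv_def legendre_conformal intro!: the_equality)

text \<open>In canonical coordinates the two functions are \<open>a * (p \<bullet> p) / f x\<close> and \<open>b * (K x \<bullet> p)\<close>. The bracket
  splits into a multiple of \<open>G \<bullet> K x\<close>, the derivative of \<open>f\<close> along \<open>K\<close>, and a multiple of
  \<open>K p \<bullet> p\<close>, which is zero because \<open>K\<close> is skew. The open set \<open>D\<close> makes the Legendre transformation
  invertible on a whole neighbourhood, as needed to differentiate through its inverse.\<close>

lemma poisson_bracket_energy_momentum:
  fixes f :: "'a::euclidean_space \<Rightarrow> real"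
  assumes D: "open D" "x \<in> D" "\<And>y. y \<in> D \<Longrightarrow> f y \<noteq> 0"
    and f: "(f has_derivative (\<lambda>w. G \<bullet> w)) (at x)"
    and K: "bounded_linear K" "\<And>u. K u \<bullet> u = 0" and G: "G \<bullet> K x = 0"
  shows "poisson_bracket (conformal_metric f)
    (\<lambda>z. a * energy f z) (\<lambda>z. b * momentum K f z) (x, v) = 0"
proof -
  define p where "p = f x *\<^sub>R v"
  have nbhd: "open (D \<times> (UNIV :: 'a set))" "(x, p) \<in> D \<times> UNIV"
    using D by (auto intro: open_Times)
  have fst_nz: "f (fst (x, p)) \<noteq> 0"
    using D by simp
  have fst: "((\<lambda>z. f (fst z)) has_derivative (\<lambda>w. G \<bullet> fst w)) (at (x, p))"
    by (rule has_derivative_compose[of fst fst _ _ f]) (use f in \<open>auto intro: derivative_intros\<close>)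
  have "((\<lambda>z. snd z \<bullet> snd z) has_derivative (\<lambda>w. 2 * (p \<bullet> snd w))) (at (x, p))"
    by (rule derivative_eq_intros refl | simp)+ (simp add: fun_eq_iff inner_commute)
  from has_derivative_divide'[OF this fst fst_nz]
  have "((\<lambda>z. (snd z \<bullet> snd z) / f (fst z)) has_derivative
      (\<lambda>(w, z). 2 * (p \<bullet> z) / f x - (G \<bullet> w) * (p \<bullet> p) / (f x)\<^sup>2)) (at (x, p))"
    by (rule has_derivative_eq_rhs)
       (use fst_nz in \<open>auto simp: fun_eq_iff diff_divide_distrib power2_eq_square\<close>)
  from has_derivative_mult_right[OF this, of a]
  have "((\<lambda>z. a * ((snd z \<bullet> snd z) / f (fst z))) has_derivative
      (\<lambda>(w, z). a * (2 * (p \<bullet> z) / f x - (G \<bullet> w) * (p \<bullet> p) / (f x)\<^sup>2))) (at (x, p))"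
    by (rule has_derivative_eq_rhs) auto
  then have "(((\<lambda>z. a * energy f z) \<circ> legendre_inv (conformal_metric f)) has_derivative
      (\<lambda>(w, z). a * (2 * (p \<bullet> z) / f x - (G \<bullet> w) * (p \<bullet> p) / (f x)\<^sup>2))) (at (x, p))"
    by (rule has_derivative_transform_within_open[OF _ nbhd])
       (auto simp: legendre_inv_conformal D energy_def)
  note E = frechet_derivative_at[OF this, symmetric]
  have "((\<lambda>z. b * (K (fst z) \<bullet> snd z)) has_derivative
      (\<lambda>(w, z). b * (K w \<bullet> p + K x \<bullet> z))) (at (x, p))"
    by (rule derivative_eq_intros bounded_linear.has_derivative[OF K(1)] refl)+
       (simp add: fun_eq_iff algebra_simps)
  then have "(((\<lambda>z. b * momentum K f z) \<circ> legendre_inv (conformal_metric f)) has_derivative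
      (\<lambda>(w, z). b * (K w \<bullet> p + K x \<bullet> z))) (at (x, p))"
    by (rule has_derivative_transform_within_open[OF _ nbhd])
       (auto simp: legendre_inv_conformal D momentum_def)
  note M = frechet_derivative_at[OF this, symmetric]
  have "(\<Sum>i\<in>Basis. (p \<bullet> i) * (K i \<bullet> p)) = K (\<Sum>i\<in>Basis. (p \<bullet> i) *\<^sub>R i) \<bullet> p"
    using bounded_linear.linear[OF K(1)]
    by (simp add: linear_sum linear_scale inner_sum_left)
  then have 1: "(\<Sum>i\<in>Basis. (p \<bullet> i) * (K i \<bullet> p)) = 0"
    by (simp add: euclidean_representation K(2))
  have 2: "(\<Sum>i\<in>Basis. (G \<bullet> i) * (K x \<bullet> i)) = 0"
    using G euclidean_inner[of G "K x"] by simp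
  have "poisson_bracket (conformal_metric f) (\<lambda>z. a * energy f z) (\<lambda>z. b * momentum K f z) (x, v)
    = (\<Sum>i\<in>Basis. - (a * b * (p \<bullet> p) / (f x)\<^sup>2) * ((G \<bullet> i) * (K x \<bullet> i))
        + - (2 * a * b / f x) * ((p \<bullet> i) * (K i \<bullet> p)))"
    unfolding poisson_bracket_def canonical_bracket_def legendre_conformal p_def[symmetric] E M
    using bounded_linear.linear[OF K(1)]
    by (intro sum.cong) (simp_all add: linear_0 field_simps)
  also have "\<dots> = 0"
    by (simp only: sum.distrib sum_distrib_left[symmetric] 1 2)
  finally show ?thesis .
qed

text \<open>The derivatives along the fibre are \<open>2 * a * f x * (v \<bullet> z)\<close> and \<open>b * f x * (K x \<bullet> z)\<close>. Testing a
  linear relation with \<open>z = x\<close>, which is orthogonal to \<open>K x\<close>, removes the first coefficient, and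
  testing with \<open>z = K x\<close> then removes the second.\<close>

lemma energy_momentum_independent:
  assumes f: "(f has_derivative (\<lambda>w. G \<bullet> w)) (at x)" and nz: "f x \<noteq> 0" "a \<noteq> 0" "b \<noteq> 0"
    and K: "bounded_linear K" "K x \<bullet> x = 0" "K x \<noteq> 0" and xv: "x \<bullet> v \<noteq> 0"
    and rel: "\<And>w. \<alpha> * frechet_derivative (\<lambda>z. a * energy f z) (at (x, v)) w
      + \<beta> * frechet_derivative (\<lambda>z. b * momentum K f z) (at (x, v)) w = 0"
  shows "\<alpha> = 0 \<and> \<beta> = 0"
proof -
  note E = frechet_derivative_at[OF has_derivative_mult_right[OF energy_has_derivative[OF f]], symmetric]
  note M = frechet_derivative_at[OF has_derivative_mult_right[OF momentum_has_derivative[OF f K(1)]], symmetric]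
  have R: "\<alpha> * (a * (2 * f x * (v \<bullet> z))) + \<beta> * (b * (f x * (K x \<bullet> z))) = 0" for z
    using rel[of "(0, z)"] bounded_linear.linear[OF K(1)] by (simp add: E M linear_0)
  have "\<alpha> = 0" using R[of x] nz xv K(2) by (simp add: inner_commute)
  then show ?thesis using R[of "K x"] nz K(3) by simp
qed

section \<open>The two patches of the holomorphic sphere\<close>

text \<open>The factor is kept free of division, so that it visibly lies in the class \<open>rational\<close>; the induced
  metric has \<open>l = - 4 * c\<close> in the northern patch and \<open>l = 4 * c\<close> in the southern one.\<close>

definition sphere_factor :: "real \<Rightarrow> complex \<Rightarrow> real" where
  "sphere_factor l x = l * ((1 - x \<bullet> x) * inverse (1 + x \<bullet> x) ^ 3)"

text \<open>The derivative is written through the gradient, a multiple of \<open>x\<close>: this is where rotational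
  symmetry enters.\<close>

lemma sphere_factor_has_derivative:
  "(sphere_factor l has_derivative
     (\<lambda>w. ((l * (4 * (x \<bullet> x) - 8) / (1 + x \<bullet> x) ^ 4) *\<^sub>R x) \<bullet> w)) (at x)"
proof -
  define r where "r = x \<bullet> x"
  \<comment> \<open>in terms of the denominator the derivative is a quotient of polynomials in \<open>q\<close>\<close>
  define q where "q = 1 + r"
  have q: "r = q - 1" "q \<noteq> 0" using one_plus_inner_nz[of x] by (simp_all add: q_def r_def)
  have "((\<lambda>r. l * ((1 - r) * inverse (1 + r) ^ 3)) has_real_derivative
      l * (2 * r - 4) / (1 + r) ^ 4) (at r)"
    unfolding q(1) using q(2)
    by (auto intro!: derivative_eq_intros simp: field_simps eval_nat_numeral)
  moreover have "((\<lambda>x. x \<bullet> x) has_derivative (\<lambda>w. 2 * (x \<bullet> w))) (at x)"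
    by (auto intro!: derivative_eq_intros simp: inner_commute)
  ultimately show ?thesis
    using has_derivative_compose[of "\<lambda>x. x \<bullet> x" "\<lambda>w. 2 * (x \<bullet> w)" x UNIV
        "\<lambda>r. l * ((1 - r) * inverse (1 + r) ^ 3)" "(*) (l * (2 * r - 4) / (1 + r) ^ 4)"]
    unfolding sphere_factor_def[abs_def] has_field_derivative_def
    by (simp add: r_def algebra_simps)
qed

lemma sphere_factor_nonzero: "l \<noteq> 0 \<Longrightarrow> cmod x \<noteq> 1 \<Longrightarrow> sphere_factor l x \<noteq> 0"
  using one_plus_inner_nz[of x] by (simp add: sphere_factor_def norm_eq_1)

lemma metric_N_conformal: "metric_N c = conformal_metric (sphere_factor (- 4 * c))"
proof -
  have "Re (u * cnj v) = u \<bullet> v" for u v by (simp add: inner_complex_def)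
  then show ?thesis
    unfolding fun_eq_iff metric_N_eq conformal_metric_def sphere_factor_def power2_norm_eq_inner
    by (simp add: divide_inverse power_inverse mult_ac)
qed

lemma metric_S_eq_metric_N: "metric_S c = metric_N (- c)"
  by (simp add: metric_S_def metric_N_def)

lemma mult_cnj_inner: "x * cnj x = of_real (x \<bullet> x)"
  by (simp add: complex_mult_cnj inner_complex_def power2_eq_square)

lemma I1_coord_energy: "I1_coord = energy (sphere_factor 1)"
proof -
  have "I1_coord (x, v) = energy (sphere_factor 1) (x, v)" for x v
  proof -
    have "(1 - x * cnj x) / (1 + x * cnj x) ^ 3 * (v * cnj v)
      = of_real ((1 - x \<bullet> x) / (1 + x \<bullet> x) ^ 3 * (v \<bullet> v))"
      unfolding mult_cnj_inner by simp
    then show ?thesis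
      unfolding I1_coord_def energy_def sphere_factor_def prod.case
      by (simp only: Re_complex_of_real) (simp add: divide_inverse power_inverse)
  qed
  then show ?thesis by auto
qed

lemma I2_coord_momentum: "I2_coord = momentum ((*) \<i>) (sphere_factor 1)"
proof -
  have "I2_coord (x, v) = momentum ((*) \<i>) (sphere_factor 1) (x, v)" for x v
  proof -
    have d: "cnj x * v - x * cnj v = 2 * \<i> * of_real ((\<i> * x) \<bullet> v)"
      by (simp add: complex_eq_iff inner_complex_def algebra_simps)
    have cancel: "A / (2 * \<i> * B) * (2 * \<i> * C) = A / B * C" for A B C :: complex
      by (cases "B = 0") (simp_all add: field_simps)
    have "(1 - x * cnj x) / (2 * \<i> * (1 + x * cnj x) ^ 3) * (cnj x * v - x * cnj v)
      = of_real ((1 - x \<bullet> x) / (1 + x \<bullet> x) ^ 3 * ((\<i> * x) \<bullet> v))"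
      unfolding mult_cnj_inner d cancel by (simp only: of_real_mult of_real_divide of_real_diff of_real_add of_real_power of_real_1)
    then have "I2_coord (x, v) = (1 - x \<bullet> x) / (1 + x \<bullet> x) ^ 3 * ((\<i> * x) \<bullet> v)"
      unfolding I2_coord_def prod.case by (simp only: Re_complex_of_real)
    then show ?thesis
      by (simp only: momentum_def sphere_factor_def prod.case divide_inverse power_inverse mult_1)
  qed
  then show ?thesis by auto
qed

lemma rational_sphere_factor_fst: "rational (\<lambda>z :: complex \<times> complex. sphere_factor l (fst z))"
proof -
  have *: "rational (\<lambda>z :: complex \<times> complex. fst z \<bullet> fst z)"
    by (intro rational_inner_complex bounded_linear_fst)
  have "rational (\<lambda>z :: complex \<times> complex. l * ((1 + - 1 * (fst z \<bullet> fst z)) *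
      (inverse (1 + fst z \<bullet> fst z) * inverse (1 + fst z \<bullet> fst z) * inverse (1 + fst z \<bullet> fst z))))"
    by (intro rational.mult rational.add rational.inverse rational.const * one_plus_inner_nz)
  then show ?thesis by (simp add: sphere_factor_def power3_eq_cube)
qed

lemma rational_energy: "rational (energy (sphere_factor l))"
  unfolding energy_def case_prod_beta
  by (intro rational.mult rational_sphere_factor_fst rational_inner_complex bounded_linear_snd)

lemma rational_momentum: "rational (momentum ((*) \<i>) (sphere_factor l))"
  unfolding momentum_def case_prod_beta
  by (intro rational.mult rational_sphere_factor_fst rational_inner_complex bounded_linear_snd
      bounded_linear_const_mult bounded_linear_fst)

lemma i_mult_skew: "bounded_linear ((*) \<i>)" "(\<i> * u) \<bullet> u = 0"
  by (auto simp: inner_complex_def intro: bounded_linear_mult_right)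

lemma inner_i_mult_self: "u \<bullet> (\<i> * u) = 0"
  by (simp add: inner_complex_def)

text \<open>Both parametrisations have this form: the first component is an inverse stereographic projection,
  and the second one is a linear function of \<open>x\<close> over \<open>1 + x \<bullet> x\<close>, because the vector \<open>c * \<i> * x\<close> is
  orthogonal to \<open>x\<close> and so leaves the denominator stationary.\<close>

lemma continuous_tangent_map_sphere:
  fixes A :: "complex \<Rightarrow> 'b::real_normed_vector"
  assumes A: "bounded_linear A"
    and X: "\<And>x. X x = (1 / (1 + x \<bullet> x)) *\<^sub>R (A x + B + (x \<bullet> x) *\<^sub>R C)"
  shows "continuous_on S (tangent_map X)"
proof -
  have "(X has_derivative (\<lambda>u. (1 / (1 + x \<bullet> x)) *\<^sub>R (A u + (2 * (x \<bullet> u)) *\<^sub>R C)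
      + (- 2 * (x \<bullet> u) / (1 + x \<bullet> x)\<^sup>2) *\<^sub>R (A x + B + (x \<bullet> x) *\<^sub>R C))) (at x)" for x
    unfolding X[abs_def]
    by (rule derivative_eq_intros bounded_linear.has_derivative[OF A] refl one_plus_inner_nz)+
       (simp add: fun_eq_iff inner_commute power2_eq_square divide_inverse mult_ac)
  note D = frechet_derivative_at[OF this, symmetric]
  show ?thesis
    unfolding tangent_map_def D X case_prod_beta
    by (intro continuous_intros bounded_linear.continuous_on[OF A]) (auto simp: one_plus_inner_nz)
qed

lemma continuous_tangent_map_Sigma_N: "continuous_on S (tangent_map (Sigma_N c))"
proof (rule continuous_tangent_map_sphere)
  show "bounded_linear (\<lambda>x. ((2 * Re x) *\<^sub>R axis 1 1 + (2 * Im x) *\<^sub>R axis 2 1,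
      (- 2 * c * Im x) *\<^sub>R axis 1 1 + (2 * c * Re x) *\<^sub>R axis 2 1) :: (real^3) \<times> (real^3))"
    by (intro bounded_linear_intros bounded_linear_Re bounded_linear_Im)
  show "Sigma_N c x = (1 / (1 + x \<bullet> x)) *\<^sub>R
      (((2 * Re x) *\<^sub>R axis 1 1 + (2 * Im x) *\<^sub>R axis 2 1,
      (- 2 * c * Im x) *\<^sub>R axis 1 1 + (2 * c * Re x) *\<^sub>R axis 2 1) + (axis 3 1, 0)
      + (x \<bullet> x) *\<^sub>R (- axis 3 1, 0))" for x
    unfolding Sigma_N_def line_N_def hol_section_def comp_def tangent_map_def prod.case
      frechet_derivative_at[OF sphere_N_has_derivative, symmetric]
    by (simp add: sphere_N_def vector_3_axis power2_norm_eq_inner algebra_simps inner_complex_def[of x "_ * _"])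
qed

lemma continuous_tangent_map_Sigma_S: "continuous_on S (tangent_map (Sigma_S c))"
proof (rule continuous_tangent_map_sphere)
  show "bounded_linear (\<lambda>x. ((2 * Re x) *\<^sub>R axis 1 1 + (- 2 * Im x) *\<^sub>R axis 2 1,
      (2 * c * Im x) *\<^sub>R axis 1 1 + (2 * c * Re x) *\<^sub>R axis 2 1) :: (real^3) \<times> (real^3))"
    by (intro bounded_linear_intros bounded_linear_Re bounded_linear_Im)
  show "Sigma_S c x = (1 / (1 + x \<bullet> x)) *\<^sub>R
      (((2 * Re x) *\<^sub>R axis 1 1 + (- 2 * Im x) *\<^sub>R axis 2 1,
      (2 * c * Im x) *\<^sub>R axis 1 1 + (2 * c * Re x) *\<^sub>R axis 2 1) + (- axis 3 1, 0)
      + (x \<bullet> x) *\<^sub>R (axis 3 1, 0))" for x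
    unfolding Sigma_S_def line_S_def hol_section_def comp_def tangent_map_def prod.case
      frechet_derivative_at[OF sphere_S_has_derivative, symmetric]
    by (simp add: sphere_S_def vector_3_axis power2_norm_eq_inner algebra_simps inner_complex_def[of x "_ * _"])
qed

text \<open>The condition \<open>x \<bullet> u \<noteq> 0\<close> thus means the same in both patches, and it can be read off from the
  tangent vector of the embedded sphere.\<close>

lemma height_velocity_Sigma_N:
  "fst (snd (tangent_map (Sigma_N c) (x, u))) $ 3 = - 4 * (x \<bullet> u) / (1 + x \<bullet> x)\<^sup>2"
proof -
  have "fst (snd (tangent_map (Sigma_N c) (x, u))) = snd (tangent_map sphere_N (x, u))"
    using tangent_map_fst_comp[OF Sigma_N_differentiable fst_Sigma(1), of c x u] by (metis snd_conv)
  then show ?thesis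
    using one_plus_inner_nz[of x]
    by (simp add: tangent_map_def frechet_derivative_at[OF sphere_N_has_derivative, symmetric]
        axis_def divide_simps) (simp add: algebra_simps power2_eq_square)
qed

lemma height_velocity_Sigma_S:
  "fst (snd (tangent_map (Sigma_S c) (x, u))) $ 3 = 4 * (x \<bullet> u) / (1 + x \<bullet> x)\<^sup>2"
proof -
  have "fst (snd (tangent_map (Sigma_S c) (x, u))) = snd (tangent_map sphere_S (x, u))"
    using tangent_map_fst_comp[OF Sigma_S_differentiable fst_Sigma(2), of c x u] by (metis snd_conv)
  then show ?thesis
    using one_plus_inner_nz[of x]
    by (simp add: tangent_map_def frechet_derivative_at[OF sphere_S_has_derivative, symmetric]
        axis_def divide_simps) (simp add: algebra_simps power2_eq_square)
qed

text \<open>The common normal form of the two patches, from which everything else follows uniformly. Since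
  $\mathrm I_1$ changes sign under $\xi\mapsto1/\xi$ and $\mathrm I_2$ does not, \<open>a\<close> is \<open>1 / l\<close> in the
  northern and \<open>- 1 / l\<close> in the southern patch, while \<open>b\<close> is \<open>1 / l\<close> in both.\<close>

lemma Sigma_patch_cases:
  assumes "c \<noteq> 0" and patch: "(X, D, g) \<in> Sigma_patches c"
  obtains f l a b where "D = {x. cmod x \<noteq> 1}" "f = sphere_factor l" "g = conformal_metric f"
    "l \<noteq> 0" "a \<noteq> 0" "b \<noteq> 0"
    "I1 \<circ> tangent_map X = (\<lambda>z. a * energy f z)"
    "I2 \<circ> tangent_map X = (\<lambda>z. b * momentum ((*) \<i>) f z)"
    "\<And>x. X differentiable at x" "\<And>S. continuous_on S (tangent_map X)"
    "\<And>x u. fst (snd (tangent_map X (x, u))) $ 3 \<noteq> 0 \<longleftrightarrow> x \<bullet> u \<noteq> 0"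
proof -
  have scale: "sphere_factor 1 x = (1 / l) * sphere_factor l x" if "l \<noteq> 0" for l x
    using that by (simp add: sphere_factor_def)
  have E: "energy (sphere_factor 1) = (\<lambda>z. (1 / l) * energy (sphere_factor l) z)"
    and M: "momentum ((*) \<i>) (sphere_factor 1) = (\<lambda>z. (1 / l) * momentum ((*) \<i>) (sphere_factor l) z)"
    if "l \<noteq> 0" for l
    by (auto simp: energy_def momentum_def scale[OF that])
  consider "X = Sigma_N c" "D = {x. cmod x \<noteq> 1}" "g = metric_N c"
    | "X = Sigma_S c" "D = {x. cmod x \<noteq> 1}" "g = metric_S c"
    using patch by (auto simp: Sigma_patches_def)
  then show thesis
  proof cases
    case 1
    have "- 4 * c \<noteq> 0" using assms by simp
    note EM = E[OF this] M[OF this]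
    show thesis
    proof (rule that[of "sphere_factor (- 4 * c)" "- 4 * c" "1 / (- 4 * c)" "1 / (- 4 * c)"])
      show "I1 \<circ> tangent_map X = (\<lambda>z. 1 / (- 4 * c) * energy (sphere_factor (- 4 * c)) z)"
        by (simp only: 1 fun_eq_iff comp_apply I1_Sigma_N I1_coord_energy EM) simp
      show "I2 \<circ> tangent_map X = (\<lambda>z. 1 / (- 4 * c) * momentum ((*) \<i>) (sphere_factor (- 4 * c)) z)"
        by (simp only: 1 fun_eq_iff comp_apply I2_Sigma_N I2_coord_momentum EM) simp
      show "fst (snd (tangent_map X (x, u))) $ 3 \<noteq> 0 \<longleftrightarrow> x \<bullet> u \<noteq> 0" for x u
        using one_plus_inner_nz[of x] by (simp add: 1 height_velocity_Sigma_N)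
    qed (use 1 assms in \<open>auto simp: metric_N_conformal Sigma_N_differentiable continuous_tangent_map_Sigma_N\<close>)
  next
    case 2
    have "4 * c \<noteq> 0" using assms by simp
    note EM = E[OF this] M[OF this]
    show thesis
    proof (rule that[of "sphere_factor (4 * c)" "4 * c" "- 1 / (4 * c)" "1 / (4 * c)"])
      show "I1 \<circ> tangent_map X = (\<lambda>z. - 1 / (4 * c) * energy (sphere_factor (4 * c)) z)"
        by (simp only: 2 fun_eq_iff comp_apply I1_Sigma_S I1_coord_energy EM) simp
      show "I2 \<circ> tangent_map X = (\<lambda>z. 1 / (4 * c) * momentum ((*) \<i>) (sphere_factor (4 * c)) z)"
        by (simp only: 2 fun_eq_iff comp_apply I2_Sigma_S I2_coord_momentum EM) simp
      show "fst (snd (tangent_map X (x, u))) $ 3 \<noteq> 0 \<longleftrightarrow> x \<bullet> u \<noteq> 0" for x u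
        using one_plus_inner_nz[of x] by (simp add: 2 height_velocity_Sigma_S)
    qed (use 2 assms in \<open>auto simp: metric_S_eq_metric_N metric_N_conformal Sigma_S_differentiable continuous_tangent_map_Sigma_S\<close>)
  qed
qed

section \<open>First integrals and independence\<close>

text \<open>A geodesic may pass from one patch to the other, so the function along it is compared with its
  coordinate expression only near each single time; a function with vanishing derivative on an
  interval is constant.\<close>

lemma first_integralI:
  assumes smooth: "\<And>X D g. (X, D, g) \<in> A \<Longrightarrow> smooth_on (D \<times> UNIV) (F \<circ> tangent_map X)"
    and diff: "\<And>X D g x. (X, D, g) \<in> A \<Longrightarrow> X differentiable at x"
    and conserved: "\<And>X D g x x' t. (X, D, g) \<in> A \<Longrightarrow> x t \<in> D \<Longrightarrow>
      (x has_vector_derivative x' t) (at t) \<Longrightarrow>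
      (x' has_vector_derivative - christoffel g (x t) (x' t) (x' t)) (at t) \<Longrightarrow>
      ((\<lambda>s. F (tangent_map X (x s, x' s))) has_vector_derivative 0) (at t)"
  shows "first_integral A F"
proof -
  have "F (\<gamma> s, vector_derivative \<gamma> (at s)) = F (\<gamma> t, vector_derivative \<gamma> (at t))"
    if J: "geodesic A J \<gamma>" "s \<in> J" "t \<in> J" for J \<gamma> s t
  proof -
    define h where "h t = F (\<gamma> t, vector_derivative \<gamma> (at t))" for t
    have "(h has_derivative (\<lambda>_. 0)) (at t within J)" if "t \<in> J" for t
    proof -
      obtain X D g T x where p: "(X, D, g) \<in> A" "open T" "t \<in> T"
        "\<And>s. s \<in> T \<Longrightarrow> x s \<in> D \<and> \<gamma> s = X (x s)" "geodesic_in_coordinates g T x"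
        using J(1) \<open>t \<in> J\<close> unfolding geodesic_def by blast
      obtain x' where x': "\<And>t. t \<in> T \<Longrightarrow> (x has_vector_derivative x' t) (at t)"
        "\<And>t. t \<in> T \<Longrightarrow> (x' has_vector_derivative - christoffel g (x t) (x' t) (x' t)) (at t)"
        using p(5) unfolding geodesic_in_coordinates_def by blast
      have h: "h s = F (tangent_map X (x s, x' s))" if "s \<in> T" for s
      proof -
        have "(X has_derivative frechet_derivative X (at (x s))) (at (x s))"
          using diff[OF p(1)] by (simp add: frechet_derivative_works)
        from has_derivative_compose[OF x'(1)[OF that, unfolded has_vector_derivative_def] this]
        have "((\<lambda>s. X (x s)) has_vector_derivative frechet_derivative X (at (x s)) (x' s)) (at s)"
          using linear_frechet_derivative[OF diff[OF p(1)]]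
          by (simp add: has_vector_derivative_def linear_scale)
        then have "(\<gamma> has_vector_derivative frechet_derivative X (at (x s)) (x' s)) (at s)"
          by (rule has_vector_derivative_transform_within_open[OF _ p(2) that]) (simp add: p(4))
        then show ?thesis
          by (simp add: h_def tangent_map_def vector_derivative_at p(4) that)
      qed
      have "((\<lambda>s. F (tangent_map X (x s, x' s))) has_vector_derivative 0) (at t)"
        using conserved[OF p(1)] p(3,4) x' by blast
      then have "(h has_vector_derivative 0) (at t)"
        by (rule has_vector_derivative_transform_within_open[OF _ p(2,3)]) (simp add: h)
      then show ?thesis
        by (simp add: has_vector_derivative_def has_derivative_at_withinI)
    qed
    then have "h s = h t"
      using J has_derivative_zero_constant[of J h]
      by (auto simp: geodesic_def is_interval_convex_1)
    then show ?thesis by (simp add: h_def)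
  qed
  then show ?thesis
    using smooth unfolding first_integral_def by blast
qed

lemma first_integral_I1:
  assumes "c \<noteq> 0"
  shows "first_integral (Sigma_patches c) I1"
proof (rule first_integralI)
  fix X D g assume p: "(X, D, g) \<in> Sigma_patches c"
  from assms p obtain f l a where *: "D = {x. cmod x \<noteq> 1}" "f = sphere_factor l"
    "g = conformal_metric f" "l \<noteq> 0" "I1 \<circ> tangent_map X = (\<lambda>z. a * energy f z)"
    "\<And>x. X differentiable at x"
    by (rule Sigma_patch_cases) blast
  show "smooth_on (D \<times> UNIV) (I1 \<circ> tangent_map X)"
    unfolding * by (intro rational_smooth_on rational.mult rational.const rational_energy)
  show "X differentiable at x" for x by fact
  fix x x' t
  assume x: "x t \<in> D" "(x has_vector_derivative x' t) (at t)"
    "(x' has_vector_derivative - christoffel g (x t) (x' t) (x' t)) (at t)"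
  have F: "I1 (tangent_map X z) = a * energy f z" for z
    using *(5) by (metis comp_apply)
  have "((\<lambda>s. energy f (x s, x' s)) has_vector_derivative 0) (at t)"
    using x unfolding *(1-3)
    by (intro energy_conserved[where x = x and x' = x' and t = t, OF _ _ sphere_factor_has_derivative])
       (auto simp: *(4) sphere_factor_nonzero)
  from bounded_linear.has_vector_derivative[OF bounded_linear_mult_right this]
  show "((\<lambda>s. I1 (tangent_map X (x s, x' s))) has_vector_derivative 0) (at t)"
    by (simp add: F)
qed

lemma first_integral_I2:
  assumes "c \<noteq> 0"
  shows "first_integral (Sigma_patches c) I2"
proof (rule first_integralI)
  fix X D g assume p: "(X, D, g) \<in> Sigma_patches c"
  from assms p obtain f l b where *: "D = {x. cmod x \<noteq> 1}" "f = sphere_factor l"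
    "g = conformal_metric f" "l \<noteq> 0" "I2 \<circ> tangent_map X = (\<lambda>z. b * momentum ((*) \<i>) f z)"
    "\<And>x. X differentiable at x"
    by (rule Sigma_patch_cases) blast
  show "smooth_on (D \<times> UNIV) (I2 \<circ> tangent_map X)"
    unfolding * by (intro rational_smooth_on rational.mult rational.const rational_momentum)
  show "X differentiable at x" for x by fact
  fix x x' t
  assume x: "x t \<in> D" "(x has_vector_derivative x' t) (at t)"
    "(x' has_vector_derivative - christoffel g (x t) (x' t) (x' t)) (at t)"
  have F: "I2 (tangent_map X z) = b * momentum ((*) \<i>) f z" for z
    using *(5) by (metis comp_apply)
  have "((\<lambda>s. momentum ((*) \<i>) f (x s, x' s)) has_vector_derivative 0) (at t)"
    using x unfolding *(1-3)
    by (intro momentum_conserved[where x = x and x' = x' and t = t, OF _ _ sphere_factor_has_derivative _ i_mult_skew])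
       (auto simp: *(4) sphere_factor_nonzero inner_i_mult_self)
  from bounded_linear.has_vector_derivative[OF bounded_linear_mult_right this]
  show "((\<lambda>s. I2 (tangent_map X (x s, x' s))) has_vector_derivative 0) (at t)"
    by (simp add: F)
qed

lemma open_off_equator: "open {x :: complex. cmod x \<noteq> 1}"
  by (intro open_Collect_neq continuous_intros)

lemma poisson_commute_I1_I2:
  assumes "c \<noteq> 0"
  shows "poisson_commute (Sigma_patches c) I1 I2"
proof -
  have "poisson_bracket g (I1 \<circ> tangent_map X) (I2 \<circ> tangent_map X) (x, v) = 0"
    if "(X, D, g) \<in> Sigma_patches c" "x \<in> D" for X D g x v
  proof -
    from assms that(1) obtain f l a b where *: "D = {x. cmod x \<noteq> 1}" "f = sphere_factor l"
      "g = conformal_metric f" "l \<noteq> 0" "I1 \<circ> tangent_map X = (\<lambda>z. a * energy f z)"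
      "I2 \<circ> tangent_map X = (\<lambda>z. b * momentum ((*) \<i>) f z)"
      by (rule Sigma_patch_cases, blast)+
    show ?thesis
      unfolding *(3,5,6) unfolding *(2)
      by (rule poisson_bracket_energy_momentum[OF _ that(2) _ sphere_factor_has_derivative i_mult_skew])
         (use * in \<open>auto simp: open_off_equator sphere_factor_nonzero inner_i_mult_self\<close>)
  qed
  then show ?thesis unfolding poisson_commute_def by auto
qed

text \<open>Perturb \<open>(x, u)\<close> in the direction \<open>(u, x)\<close> if \<open>x \<bullet> u = 0\<close>: the product then becomes
  \<open>e * (x \<bullet> x + u \<bullet> u)\<close>. Only the origin needs another direction.\<close>

lemma dense_inner_nonzero:
  "(x :: complex, u) \<in> closure {(y, w). y \<bullet> w \<noteq> 0}"
proof -
  have *: "(x, u) \<in> closure {(y, w). y \<bullet> w \<noteq> 0}"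
    if nz: "\<And>e. e > 0 \<Longrightarrow> e < 1 \<Longrightarrow> (x + e *\<^sub>R y) \<bullet> (u + e *\<^sub>R w) \<noteq> 0" for y w
  proof (rule Lim_in_closed_set[OF closed_closure])
    show "((\<lambda>e :: real. (x + e *\<^sub>R y, u + e *\<^sub>R w)) \<longlongrightarrow> (x, u)) (at_right 0)"
      by (auto intro!: tendsto_eq_intros)
    show "\<forall>\<^sub>F e in at_right 0. (x + e *\<^sub>R y, u + e *\<^sub>R w) \<in> closure {(y, w). y \<bullet> w \<noteq> 0}"
      using eventually_at_right[of 0 "1::real"] nz
      by (auto simp: eventually_at_right_field intro!: exI[of _ 1] subsetD[OF closure_subset])
  qed simp
  consider "x \<bullet> u \<noteq> 0" | "x \<bullet> u = 0" "x \<noteq> 0 \<or> u \<noteq> 0" | "x = 0" "u = 0" by auto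
  then show ?thesis
  proof cases
    case 1
    then show ?thesis by (intro subsetD[OF closure_subset]) simp
  next
    case 2
    then have "x \<bullet> x + u \<bullet> u > 0"
      by (metis add_nonneg_pos add_pos_nonneg inner_ge_zero inner_gt_zero_iff)
    moreover have "(x + e *\<^sub>R u) \<bullet> (u + e *\<^sub>R x) = e * (x \<bullet> x + u \<bullet> u)" for e
      using 2 by (simp add: inner_simps inner_commute algebra_simps)
    ultimately show ?thesis by (intro *[of u x]) simp
  next
    case 3
    then show ?thesis by (intro *[of 1 1]) simp
  qed
qed

lemma I1_I2_independent_on_dense_open_set:
  assumes "c \<noteq> 0"
  shows "\<exists>U. openin (top_of_set (tangent_bundle (Sigma_patches c))) U \<and>
    tangent_bundle (Sigma_patches c) \<subseteq> closure U \<and>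
    functionally_independent_on (Sigma_patches c) U I1 I2"
proof (intro exI conjI)
  let ?TB = "tangent_bundle (Sigma_patches c)"
  \<comment> \<open>the height \<open>p $ 3\<close> on the sphere changes at a nonzero rate\<close>
  let ?V = "{w :: ((real^3) \<times> (real^3)) \<times> ((real^3) \<times> (real^3)). fst (snd w) $ 3 \<noteq> 0}"
  have "open ?V"
    by (intro open_Collect_neq continuous_intros)
  then show "openin (top_of_set ?TB) (?TB \<inter> ?V)"
    by (rule openin_open_Int)
  show "?TB \<subseteq> closure (?TB \<inter> ?V)"
  proof
    fix w assume "w \<in> ?TB"
    then obtain X D g x u where p: "(X, D, g) \<in> Sigma_patches c" "x \<in> D" "w = tangent_map X (x, u)"
      unfolding tangent_bundle_def by auto
    from assms p(1) have *: "D = {x. cmod x \<noteq> 1}"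
      "\<And>S. continuous_on S (tangent_map X)"
      "\<And>x u. fst (snd (tangent_map X (x, u))) $ 3 \<noteq> 0 \<longleftrightarrow> x \<bullet> u \<noteq> 0"
      by (rule Sigma_patch_cases, blast)+
    let ?S = "D \<times> UNIV \<inter> {(y, w). y \<bullet> w \<noteq> 0}"
    have "(x, u) \<in> closure ?S"
      using p(2) dense_inner_nonzero open_Int_closure_subset[of "D \<times> UNIV" "{(y, w). y \<bullet> w \<noteq> 0}"]
      by (auto simp: * open_off_equator open_Times)
    moreover have "tangent_map X ` closure ?S \<subseteq> closure (tangent_map X ` ?S)"
      by (rule image_closure_subset[OF *(2) closed_closure closure_subset])
    moreover have "tangent_map X ` ?S \<subseteq> ?TB \<inter> ?V"
      using p(1) *(3) unfolding tangent_bundle_def by fastforce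
    ultimately show "w \<in> closure (?TB \<inter> ?V)"
      unfolding p(3) using closure_mono by blast
  qed
  have "\<alpha> = 0 \<and> \<beta> = 0"
    if p: "(X, D, g) \<in> Sigma_patches c" "x \<in> D" "tangent_map X (x, v) \<in> ?TB \<inter> ?V"
      and rel: "\<forall>w. \<alpha> * frechet_derivative (I1 \<circ> tangent_map X) (at (x, v)) w
        + \<beta> * frechet_derivative (I2 \<circ> tangent_map X) (at (x, v)) w = 0" for X D g x v \<alpha> \<beta>
  proof -
    from assms p(1) obtain f l a b where *: "D = {x. cmod x \<noteq> 1}" "f = sphere_factor l"
      "l \<noteq> 0" "a \<noteq> 0" "b \<noteq> 0" "I1 \<circ> tangent_map X = (\<lambda>z. a * energy f z)"
      "I2 \<circ> tangent_map X = (\<lambda>z. b * momentum ((*) \<i>) f z)"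
      "\<And>x u. fst (snd (tangent_map X (x, u))) $ 3 \<noteq> 0 \<longleftrightarrow> x \<bullet> u \<noteq> 0"
      by (rule Sigma_patch_cases, blast)+
    have xv: "x \<bullet> v \<noteq> 0" using p(3) *(8) by auto
    then have "\<i> * x \<noteq> 0" by auto
    moreover have "sphere_factor l x \<noteq> 0" using p(2) * by (simp add: sphere_factor_nonzero)
    ultimately show ?thesis
      using energy_momentum_independent[OF sphere_factor_has_derivative _ *(4,5) i_mult_skew _ xv] rel
      unfolding *(6,7) unfolding *(2) by blast
  qed
  then show "functionally_independent_on (Sigma_patches c) (?TB \<inter> ?V) I1 I2"
    unfolding functionally_independent_on_def by fast
qed

theorem proposition5:
  fixes c :: real
  assumes "c > 0"
  shows "completely_integrable_with (Sigma_patches c) I1 I2"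
  using assms unfolding completely_integrable_with_def
  by (simp add: first_integral_I1 first_integral_I2 poisson_commute_I1_I2
      I1_I2_independent_on_dense_open_set)

end
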